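(* Let $\langle W, \mathfrak{W} \rangle$ be a t2-frame and let $\mathcal{N}^{t}_{w}$ ($w \in W$) be the families of subsets of $W$ induced by it as defined in the context. Then these families have all the properties of the neighborhood families of an n2-frame, i.e. $\langle W, \mathcal{N}^{t} \rangle$, with $\mathcal{N}^t : w \mapsto \mathcal{N}^{t}_{w}$, is an n2-frame.
   Context: An n2-frame is an ordered pair $\langle W, \mathcal{N} \rangle$ where $W$ is a non-empty set and $\mathcal{N}$ is a function from $W$ into $P(P(W))$ (write $\mathcal{N}_w$ for $\mathcal{N}(w)$) such that, for all $w,u,v \in W$ and $X \subseteq W$: (a) $w \in \bigcap \mathcal{N}_{w}$; (b) $\bigcap \mathcal{N}_{w} \in \mathcal{N}_{w}$; (c) if $u \in \bigcap \mathcal{N}_{w}$ then $\bigcap \mathcal{N}_{u} \subseteq \bigcap \mathcal{N}_{w}$; (d) if $X \subseteq \bigcup \mathcal{N}_{w}$ and $\bigcap \mathcal{N}_{w} \subseteq X$ then $X \in \mathcal{N}_{w}$; (e) if $u \in \bigcap \mathcal{N}_{w}$ then $\bigcup \mathcal{N}_{u} \subseteq \bigcup \mathcal{N}_{w}$; (f) if $v \in \bigcup \mathcal{N}_{w}$ then $\bigcap \mathcal{N}_{v} \subseteq \bigcup \mathcal{N}_{w}$. A t2-frame is an ordered pair $\langle W, \mathfrak{W} \rangle$ where $W \neq \emptyset$; $\mathfrak{W}$ is a collection of pairs $\langle T, \tau \rangle$ with $T \subseteq W$ and $\tau$ an Alexandroff topology on $T$ (arbitrary intersections of open sets are open); and every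 $w \in W$ belongs to $T$ for some $\langle T, \tau \rangle \in \mathfrak{W}$. For $\langle T,\tau\rangle \in \mathfrak{W}$ and $w \in T$, $\mathcal{O}^{w}_{\tau}$ denotes the family of $\tau$-open sets containing $w$, and $\min \mathcal{O}^{w}_{\tau} = \bigcap \mathcal{O}^{w}_{\tau}$ is the minimal $\tau$-open neighborhood of $w$. Induced families: for $w \in W$ put $\mathcal{T}^{w} = \{\langle T, \tau \rangle \in \mathfrak{W} : w \in T\}$, $m_w = \bigcap_{\langle T, \tau \rangle \in \mathcal{T}^{w}} \min \mathcal{O}^{w}_{\tau}$ and $M_w = \bigcap_{\langle T, \tau\rangle \in \mathcal{T}^{w}} T$. Define $\mathcal{N}^{t}_{w} \subseteq P(W)$ by: $X \in \mathcal{N}^{t}_{w} \Leftrightarrow m_w \subseteq X \subseteq M_w$. (The paper denotes $m_w$ by $\bigcap \mathcal{N}^{t}_{w}$ and $M_w$ by $\bigcup \mathcal{N}^{t}_{w}$.) *)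

theory Defs
  imports "HOL-Library.FuncSet" "HOL-Analysis.Abstract_Topology"
begin

definition n2_frame :: "'a set \<Rightarrow> ('a \<Rightarrow> 'a set set) \<Rightarrow> bool" where
  "n2_frame W N \<longleftrightarrow>
     W \<noteq> {} \<and>
     N \<in> W \<rightarrow> Pow (Pow W) \<and>
     (\<forall>w\<in>W. w \<in> \<Inter>(N w)) \<and>
     (\<forall>w\<in>W. \<Inter>(N w) \<in> N w) \<and>
     (\<forall>w\<in>W. \<forall>u\<in>W. u \<in> \<Inter>(N w) \<longrightarrow> \<Inter>(N u) \<subseteq> \<Inter>(N w)) \<and>
     (\<forall>w\<in>W. \<forall>X\<subseteq>W. X \<subseteq> \<Union>(N w) \<and> \<Inter>(N w) \<subseteq> X \<longrightarrow> X \<in> N w) \<and>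
     (\<forall>w\<in>W. \<forall>u\<in>W. u \<in> \<Inter>(N w) \<longrightarrow> \<Union>(N u) \<subseteq> \<Union>(N w)) \<and>
     (\<forall>w\<in>W. \<forall>v\<in>W. v \<in> \<Union>(N w) \<longrightarrow> \<Inter>(N v) \<subseteq> \<Union>(N w))"

text \<open>The empty family is excluded because its \<open>\<Inter>\<close> is the whole type; relative to the
  carrier its intersection is \<open>topspace \<tau>\<close>, which is open anyway.\<close>
definition alexandroff :: "'a topology \<Rightarrow> bool" where
  "alexandroff \<tau> \<longleftrightarrow> (\<forall>\<U>. \<U> \<noteq> {} \<and> (\<forall>U\<in>\<U>. openin \<tau> U) \<longrightarrow> openin \<tau> (\<Inter>\<U>))"

definition t2_frame :: "'a set \<Rightarrow> ('a set \<times> 'a topology) set \<Rightarrow> bool" where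
  "t2_frame W \<WW> \<longleftrightarrow>
     W \<noteq> {} \<and>
     (\<forall>(T, \<tau>)\<in>\<WW>. T \<subseteq> W \<and> topspace \<tau> = T \<and> alexandroff \<tau>) \<and>
     (\<forall>w\<in>W. \<exists>(T, \<tau>)\<in>\<WW>. w \<in> T)"

definition open_nbhds :: "'a topology \<Rightarrow> 'a \<Rightarrow> 'a set set" where
  "open_nbhds \<tau> w = {U. openin \<tau> U \<and> w \<in> U}"

definition min_open_nbhd :: "'a topology \<Rightarrow> 'a \<Rightarrow> 'a set" where
  "min_open_nbhd \<tau> w = \<Inter>(open_nbhds \<tau> w)"

definition spaces_at :: "('a set \<times> 'a topology) set \<Rightarrow> 'a \<Rightarrow> ('a set \<times> 'a topology) set" where
  "spaces_at \<WW> w = {(T, \<tau>). (T, \<tau>) \<in> \<WW> \<and> w \<in> T}"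

definition min_nbhd :: "('a set \<times> 'a topology) set \<Rightarrow> 'a \<Rightarrow> 'a set" where
  "min_nbhd \<WW> w = (\<Inter>(T, \<tau>)\<in>spaces_at \<WW> w. min_open_nbhd \<tau> w)"

definition max_nbhd :: "('a set \<times> 'a topology) set \<Rightarrow> 'a \<Rightarrow> 'a set" where
  "max_nbhd \<WW> w = (\<Inter>(T, \<tau>)\<in>spaces_at \<WW> w. T)"

definition induced_nbhds ::
    "'a set \<Rightarrow> ('a set \<times> 'a topology) set \<Rightarrow> 'a \<Rightarrow> 'a set set" where
  "induced_nbhds W \<WW> w = {X \<in> Pow W. min_nbhd \<WW> w \<subseteq> X \<and> X \<subseteq> max_nbhd \<WW> w}"

end

theory Submission
  imports Defs
begin

text \<open>Everything rests on two observations. First, \<open>\<N>\<^sub>w\<close> is the full interval of sets between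
  \<open>m\<^sub>w\<close> and \<open>M\<^sub>w\<close>, and \<open>m\<^sub>w \<subseteq> M\<^sub>w \<subseteq> W\<close>; hence both endpoints belong to it, its intersection is \<open>m\<^sub>w\<close>
  and its union is \<open>M\<^sub>w\<close>. The frame conditions thereby become statements about \<open>m\<close> and \<open>M\<close> alone.
  Second, \<open>v \<in> M\<^sub>w\<close> says precisely that every space of the frame containing \<open>w\<close> also contains
  \<open>v\<close>, so that passing from \<open>w\<close> to \<open>v\<close> enlarges the collection of spaces over which the defining
  intersections are taken. This yields \<open>M\<^sub>v \<subseteq> M\<^sub>w\<close>, and, because minimal neighborhoods lie inside
  their spaces, \<open>m\<^sub>v \<subseteq> M\<^sub>w\<close>. If moreover \<open>v \<in> m\<^sub>w\<close>, then every open set around \<open>w\<close> is also an open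
  set around \<open>v\<close>, which gives \<open>m\<^sub>v \<subseteq> m\<^sub>w\<close>.\<close>

lemma mem_min_nbhd_iff:
  "x \<in> min_nbhd \<WW> w \<longleftrightarrow>
     (\<forall>T \<tau> U. (T, \<tau>) \<in> \<WW> \<and> w \<in> T \<and> openin \<tau> U \<and> w \<in> U \<longrightarrow> x \<in> U)"
  by (auto simp: min_nbhd_def min_open_nbhd_def open_nbhds_def spaces_at_def)

lemma mem_max_nbhd_iff:
  "x \<in> max_nbhd \<WW> w \<longleftrightarrow> (\<forall>T \<tau>. (T, \<tau>) \<in> \<WW> \<and> w \<in> T \<longrightarrow> x \<in> T)"
  by (auto simp: max_nbhd_def spaces_at_def)

lemma mem_min_nbhd_self: "w \<in> min_nbhd \<WW> w"
  by (simp add: mem_min_nbhd_iff)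

text \<open>The whole space \<open>T\<close> is itself one of the open neighborhoods being intersected.\<close>
lemma min_nbhd_subset_max_nbhd:
  assumes "\<And>T \<tau>. (T, \<tau>) \<in> \<WW> \<Longrightarrow> topspace \<tau> = T"
  shows "min_nbhd \<WW> w \<subseteq> max_nbhd \<WW> w"
  unfolding subset_iff mem_min_nbhd_iff mem_max_nbhd_iff
  using assms openin_topspace by metis

lemma max_nbhd_mono:
  assumes "v \<in> max_nbhd \<WW> w"
  shows "max_nbhd \<WW> v \<subseteq> max_nbhd \<WW> w"
  using assms unfolding subset_iff mem_max_nbhd_iff by blast

text \<open>An open set around \<open>w\<close> contains \<open>v\<close>; it counts among the sets defining \<open>m\<^sub>v\<close> because the
  space it comes from contains \<open>v\<close> as well.\<close>
lemma min_nbhd_mono: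
  assumes "\<And>T \<tau>. (T, \<tau>) \<in> \<WW> \<Longrightarrow> topspace \<tau> = T"
    and "v \<in> min_nbhd \<WW> w"
  shows "min_nbhd \<WW> v \<subseteq> min_nbhd \<WW> w"
proof -
  have "v \<in> max_nbhd \<WW> w"
    using min_nbhd_subset_max_nbhd[OF assms(1)] assms(2) by blast
  then show ?thesis
    using assms(2) unfolding subset_iff mem_min_nbhd_iff mem_max_nbhd_iff by blast
qed

text \<open>Some space of the frame must contain \<open>w\<close>: otherwise the intersection defining \<open>M\<^sub>w\<close> would be
  empty and hence equal to the whole type.\<close>
lemma max_nbhd_subset_carrier:
  assumes "t2_frame W \<WW>" and "w \<in> W"
  shows "max_nbhd \<WW> w \<subseteq> W"
proof -
  obtain T \<tau> where "(T, \<tau>) \<in> \<WW>" "w \<in> T"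
    using assms unfolding t2_frame_def by blast
  moreover from this have "T \<subseteq> W"
    using assms(1) unfolding t2_frame_def by blast
  ultimately show ?thesis
    unfolding subset_iff mem_max_nbhd_iff by blast
qed

theorem theorem7p3:
  fixes W :: "'a set" and \<WW> :: "('a set \<times> 'a topology) set"
  assumes "t2_frame W \<WW>"
  shows "n2_frame W (induced_nbhds W \<WW>)"
proof -
  let ?N = "induced_nbhds W \<WW>" and ?m = "min_nbhd \<WW>" and ?M = "max_nbhd \<WW>"
  have "W \<noteq> {}" and top: "\<And>T \<tau>. (T, \<tau>) \<in> \<WW> \<Longrightarrow> topspace \<tau> = T"
    using assms unfolding t2_frame_def by auto
  have m_le_M: "?m w \<subseteq> ?M w" for w
    by (rule min_nbhd_subset_max_nbhd[OF top])
  have M_le_W: "?M w \<subseteq> W" if "w \<in> W" for w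
    by (rule max_nbhd_subset_carrier[OF assms that])
  have N_iff: "X \<in> ?N w \<longleftrightarrow> ?m w \<subseteq> X \<and> X \<subseteq> ?M w" if "w \<in> W" for w X
    using M_le_W[OF that] by (auto simp: induced_nbhds_def)
  have Inter_N: "\<Inter>(?N w) = ?m w" and Union_N: "\<Union>(?N w) = ?M w" if "w \<in> W" for w
  proof -
    have "?m w \<in> ?N w" "?M w \<in> ?N w"
      using m_le_M by (auto simp: N_iff[OF that])
    then show "\<Inter>(?N w) = ?m w" "\<Union>(?N w) = ?M w"
      using N_iff[OF that] by blast+
  qed
  have m_mono: "?m u \<subseteq> ?m w" if "u \<in> ?m w" for u w
    by (rule min_nbhd_mono[OF top that])
  have M_mono: "?M u \<subseteq> ?M w" if "u \<in> ?M w" for u w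
    by (rule max_nbhd_mono[OF that])
  show ?thesis
    unfolding n2_frame_def
  proof (intro conjI ballI allI impI)
    show "W \<noteq> {}" by fact
    show "?N \<in> W \<rightarrow> Pow (Pow W)"
      by (auto simp: induced_nbhds_def)
  next
    fix w assume w: "w \<in> W"
    show "w \<in> \<Inter>(?N w)"
      using mem_min_nbhd_self by (simp only: Inter_N[OF w])
    show "\<Inter>(?N w) \<in> ?N w"
      using m_le_M by (simp add: Inter_N[OF w] N_iff[OF w])
    show "X \<in> ?N w" if "X \<subseteq> \<Union>(?N w) \<and> \<Inter>(?N w) \<subseteq> X" for X
      using that by (simp only: Inter_N[OF w] Union_N[OF w] N_iff[OF w])
    fix u assume u: "u \<in> W"
    show "\<Inter>(?N u) \<subseteq> \<Inter>(?N w)" if "u \<in> \<Inter>(?N w)"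
      using that m_mono by (simp only: Inter_N[OF w] Inter_N[OF u])
    show "\<Union>(?N u) \<subseteq> \<Union>(?N w)" if "u \<in> \<Inter>(?N w)"
      using that M_mono m_le_M[of w] unfolding Inter_N[OF w] Union_N[OF w] Union_N[OF u] by blast
    show "\<Inter>(?N u) \<subseteq> \<Union>(?N w)" if "u \<in> \<Union>(?N w)"
      using that M_mono m_le_M[of u] unfolding Inter_N[OF u] Union_N[OF w] by blast
  qed
qed

end
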